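(* Let $k\ge 1$ and let $1\le s_1<s_2<\ldots<s_k$ be fixed integers. For each integer $n$ with $s_k<\frac{n}{2}$, let $f_{G}(n)$ be the number of rooted spanning forests in the circulant graph $G=C_{n}(s_1,s_2,\ldots,s_k)$. Denote by $p$ the number of odd elements in the sequence $s_1,s_2,\ldots,s_k$ and let $q$ be the square-free part of $4p+1$. Then there exists an integer sequence $a(n)$ such that (1) $f_{G}(n)=a(n)^2$ if $n$ is odd; (2) $f_{G}(n)=q\,a(n)^2$ if $n$ is even.
   Context: The circulant graph $C_{n}(s_1,\ldots,s_k)$ (with $1\le s_1<\ldots<s_k\le \frac n2$) is the simple undirected graph with vertices $0,1,\ldots,n-1$ in which each vertex $i$ is adjacent to the vertices $i\pm s_1, i\pm s_2,\ldots,i\pm s_k \pmod n$. A rooted spanning forest of a graph is a spanning acyclic subgraph (containing all the vertices) together with a choice of one distinguished vertex (root) in each connected component. Any positive integer $m$ can be uniquely written as $m=q\,r^2$ with $q,r$ positive integers and $q$ square-free; $q$ is called the square-free part of $m$. *)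

theory Defs
  imports "HOL-Computational_Algebra.Squarefree" "HOL-Number_Theory.Number_Theory"
begin

text \<open>Undirected graphs are a vertex set with a set of two-element edges. Symmetric digraphs
  do not serve here: a single undirected edge would already be a directed cycle.\<close>

record 'a ugraph =
  uverts :: "'a set"
  uedges :: "'a set set"

definition simple_ugraph :: "'a ugraph \<Rightarrow> bool" where
  "simple_ugraph G \<longleftrightarrow>
     finite (uverts G) \<and> (\<forall>e\<in>uedges G. e \<subseteq> uverts G \<and> card e = 2)"

definition spanning_usubgraph :: "'a ugraph \<Rightarrow> 'a ugraph \<Rightarrow> bool" where
  "spanning_usubgraph H G \<longleftrightarrow> uverts H = uverts G \<and> uedges H \<subseteq> uedges G"

text \<open>A cycle is given by the list of its vertices, the first one not being repeated at the
  end; the edge between the last and the first vertex is the case \<open>i = length vs - 1\<close>.\<close>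

definition ucycle :: "'a ugraph \<Rightarrow> 'a list \<Rightarrow> bool" where
  "ucycle G vs \<longleftrightarrow>
     3 \<le> length vs \<and> distinct vs \<and> set vs \<subseteq> uverts G \<and>
     (\<forall>i<length vs. {vs ! i, vs ! (Suc i mod length vs)} \<in> uedges G)"

definition uacyclic :: "'a ugraph \<Rightarrow> bool" where
  "uacyclic G \<longleftrightarrow> (\<nexists>vs. ucycle G vs)"

definition uconnected_rel :: "'a ugraph \<Rightarrow> ('a \<times> 'a) set" where
  "uconnected_rel G = {(u, v) \<in> uverts G \<times> uverts G. (u, v) \<in> {(x, y). {x, y} \<in> uedges G}\<^sup>*}"

definition ucomponents :: "'a ugraph \<Rightarrow> 'a set set" where
  "ucomponents G = uverts G // uconnected_rel G"

text \<open>As the components are disjoint, choosing a root in each of them is the same as giving a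
  set of vertices that meets every component in exactly one vertex.\<close>

definition rooted_spanning_forests :: "'a ugraph \<Rightarrow> ('a ugraph \<times> 'a set) set" where
  "rooted_spanning_forests G =
     {(F, R). spanning_usubgraph F G \<and> uacyclic F \<and> R \<subseteq> uverts F \<and>
              (\<forall>C\<in>ucomponents F. \<exists>!r. r \<in> C \<inter> R)}"

definition circulant_graph :: "nat \<Rightarrow> nat set \<Rightarrow> nat ugraph" where
  "circulant_graph n S =
     \<lparr>uverts = {0..<n},
      uedges = {{i, j} | i j. i < n \<and> j < n \<and>
                  (\<exists>t\<in>S. [int j = int i + int t] (mod int n) \<or> [int j = int i - int t] (mod int n))}\<rparr>"

lemma simple_circulant_graph:
  assumes "\<And>t. t \<in> S \<Longrightarrow> 1 \<le> t \<and> 2 * t \<le> n"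
  shows "simple_ugraph (circulant_graph n S)"
proof -
  have "i \<noteq> j"
    if "i < n" "t \<in> S" "[int j = int i + int t] (mod int n) \<or> [int j = int i - int t] (mod int n)"
    for i j t
  proof
    assume "i = j"
    with that(3) have "int n dvd int t"
      by (auto simp: cong_iff_dvd_diff)
    then have "n dvd t"
      by simp
    with assms[OF that(2)] that(1) show False
      by (auto dest: dvd_imp_le)
  qed
  then show ?thesis
    by (auto simp: simple_ugraph_def circulant_graph_def)
qed

end

theory Submission
  imports Defs "Jordan_Normal_Form.Determinant"
begin

text \<open>The number of rooted spanning forests of a graph is \<open>det (I + L)\<close>, where \<open>L\<close> is the
  Laplacian (lemma \<open>matrix_forest_theorem\<close>). Orienting every tree towards its root turns a rooted
  forest into a map \<open>\<phi>\<close> that sends each vertex to its parent and fixes the roots; the maps that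
  arise are those that move every vertex to a neighbour or fix it and have no cycle of length
  greater than one. Row \<open>i\<close> of \<open>I + L\<close> is the sum of \<open>e\<^sub>i\<close> and of \<open>e\<^sub>i - e\<^sub>w\<close> over the neighbours
  \<open>w\<close> of \<open>i\<close>, so expanding the determinant in its rows gives one term for each choice \<open>\<phi>\<close> of a
  neighbour or of \<open>i\<close> itself in every row, and this term is 1 if \<open>\<phi>\<close> is acyclic and 0 otherwise.

  For a circulant graph \<open>I + L\<close> acts on the \<open>n\<close>-periodic functions on the integers. It commutes
  with translations and with the reflection \<open>l \<mapsto> - l\<close>, hence it preserves the odd periodic functions;
  let \<open>A\<close> be the integer matrix of this restriction in the basis \<open>odd_delta\<close>. If \<open>b\<close> is odd,
  then its difference \<open>l \<mapsto> b (l + 1) - b (l - 1)\<close> is even. Since \<open>I + L\<close> commutes with differences,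
  it acts on the differences of odd functions by the same matrix \<open>A\<close>. Modulo these two
  subspaces the rational periodic functions are spanned by the constant function, with
  eigenvalue 1, and for even \<open>n\<close> also by the alternating function, with eigenvalue \<open>4 * p + 1\<close>,
  where \<open>p\<close> is the number of odd jumps. Therefore
  \<open>det (I + L)\<close> is \<open>(det A)\<^sup>2\<close> for odd \<open>n\<close> and \<open>(4 * p + 1) * (det A)\<^sup>2\<close> for even \<open>n\<close>
  (lemma \<open>det_circulant_forest_matrix\<close>). The square factor of \<open>4 * p + 1\<close> can then be moved into the
  square, and \<open>det A\<close> is an integer because \<open>A\<close> has integer entries.\<close>

section \<open>Rooted forests as parent maps\<close>

definition edge_rel :: "'a ugraph \<Rightarrow> ('a \<times> 'a) set" where
  "edge_rel G = {(x, y). {x, y} \<in> uedges G}"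

lemma ucomponents_eq:
  "ucomponents G = (\<lambda>v. {w \<in> uverts G. (v, w) \<in> (edge_rel G)\<^sup>*}) ` uverts G"
  unfolding ucomponents_def uconnected_rel_def quotient_def edge_rel_def by auto

text \<open>Roots are the fixed points, which is unambiguous because the graphs have no loops.
  Extensionality makes the set finite and the maps determined by their values on the vertices; the
  last condition says that every vertex reaches a root.\<close>

definition parent_maps :: "'a ugraph \<Rightarrow> ('a \<Rightarrow> 'a) set" where
  "parent_maps G =
     {\<phi> \<in> (\<Pi>\<^sub>E v\<in>uverts G. insert v {w. {v, w} \<in> uedges G}).
        \<forall>v\<in>uverts G. \<exists>k. \<phi> ((\<phi> ^^ k) v) = (\<phi> ^^ k) v}"

definition forest_of :: "'a ugraph \<Rightarrow> ('a \<Rightarrow> 'a) \<Rightarrow> 'a ugraph \<times> 'a set" where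
  "forest_of G \<phi> =
     (\<lparr>uverts = uverts G, uedges = {{v, \<phi> v} | v. v \<in> uverts G \<and> \<phi> v \<noteq> v}\<rparr>,
      {v \<in> uverts G. \<phi> v = v})"

definition depth :: "('a \<Rightarrow> 'a) \<Rightarrow> 'a \<Rightarrow> nat" where
  "depth \<phi> v = (LEAST k. \<phi> ((\<phi> ^^ k) v) = (\<phi> ^^ k) v)"

definition root_of :: "('a \<Rightarrow> 'a) \<Rightarrow> 'a \<Rightarrow> 'a" where
  "root_of \<phi> v = (\<phi> ^^ depth \<phi> v) v"

lemma simple_ugraph_edgeD:
  assumes "simple_ugraph G" "{u, v} \<in> uedges G"
  shows "u \<in> uverts G" "v \<in> uverts G" "u \<noteq> v"
proof -
  have "{u, v} \<subseteq> uverts G \<and> card {u, v} = 2"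
    using assms unfolding simple_ugraph_def by blast
  then show "u \<in> uverts G" "v \<in> uverts G" "u \<noteq> v" by (auto simp: card_insert_if)
qed

lemma parent_maps_closed:
  assumes "simple_ugraph G" "\<phi> \<in> parent_maps G" "v \<in> uverts G"
  shows "\<phi> v \<in> uverts G"
proof -
  have "\<phi> v \<in> insert v {w. {v, w} \<in> uedges G}"
    using assms(2,3) by (auto simp: parent_maps_def PiE_iff)
  then show ?thesis using assms(1,3) simple_ugraph_edgeD by fastforce
qed

lemma parent_maps_edge:
  assumes "\<phi> \<in> parent_maps G" "v \<in> uverts G" "\<phi> v \<noteq> v"
  shows "{v, \<phi> v} \<in> uedges G"
  using assms by (auto simp: parent_maps_def PiE_iff)

lemma depth_fixpoint: "\<phi> v = v \<Longrightarrow> depth \<phi> v = 0"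
  by (auto simp: depth_def intro: Least_equality)

lemma depth_step:
  assumes "\<phi> \<in> parent_maps G" "v \<in> uverts G" "\<phi> v \<noteq> v"
  shows "depth \<phi> v = Suc (depth \<phi> (\<phi> v))"
proof -
  obtain k where "\<phi> ((\<phi> ^^ k) v) = (\<phi> ^^ k) v"
    using assms by (auto simp: parent_maps_def)
  from Least_Suc[where P = "\<lambda>k. \<phi> ((\<phi> ^^ k) v) = (\<phi> ^^ k) v", OF this] assms(3)
  show ?thesis
    by (simp add: depth_def funpow_swap1)
qed

lemma root_of_fixpoint: "\<phi> v = v \<Longrightarrow> root_of \<phi> v = v"
  by (simp add: root_of_def depth_fixpoint)

lemma root_of_parent:
  assumes "\<phi> \<in> parent_maps G" "v \<in> uverts G"
  shows "root_of \<phi> (\<phi> v) = root_of \<phi> v"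
  using depth_step[OF assms] by (cases "\<phi> v = v") (auto simp: root_of_def funpow_swap1)

text \<open>Induction from the roots towards the leaves, along the depth.\<close>

lemma parent_maps_induct [consumes 3, case_names root parent]:
  assumes "simple_ugraph G" "\<phi> \<in> parent_maps G" "v \<in> uverts G"
    and "\<And>v. v \<in> uverts G \<Longrightarrow> \<phi> v = v \<Longrightarrow> P v"
    and "\<And>v. v \<in> uverts G \<Longrightarrow> \<phi> v \<noteq> v \<Longrightarrow> \<phi> v \<in> uverts G \<Longrightarrow> P (\<phi> v) \<Longrightarrow> P v"
  shows "P v"
  using assms(3)
proof (induction "depth \<phi> v" arbitrary: v rule: less_induct)
  case less
  show ?case
  proof (cases "\<phi> v = v")
    case True
    then show ?thesis using assms(4) less.prems by blast
  next
    case False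
    then have "P (\<phi> v)"
      using less.hyps less.prems depth_step[OF assms(2) less.prems False]
        parent_maps_closed[OF assms(1,2) less.prems] by simp
    then show ?thesis
      using assms(5)[OF less.prems False parent_maps_closed[OF assms(1,2) less.prems]] by blast
  qed
qed

text \<open>On a cycle, take a vertex of maximal depth. Parents are one level higher, so both of its
  neighbours on the cycle must be its parent, although they are distinct.\<close>

lemma forest_of_uacyclic:
  assumes "\<phi> \<in> parent_maps G"
  shows "uacyclic (fst (forest_of G \<phi>))"
  unfolding uacyclic_def
proof
  let ?F = "fst (forest_of G \<phi>)"
  assume "\<exists>vs. ucycle ?F vs"
  then obtain vs where len: "3 \<le> length vs" and dist: "distinct vs"
    and sub: "set vs \<subseteq> uverts G"
    and edges: "\<And>i. i < length vs \<Longrightarrow> {vs ! i, vs ! (Suc i mod length vs)} \<in> uedges ?F"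
    by (auto simp: ucycle_def forest_of_def)
  let ?l = "length vs"
  obtain x where x: "x \<in> set vs" and xmax: "\<And>y. y \<in> set vs \<Longrightarrow> depth \<phi> y \<le> depth \<phi> x"
  proof -
    have "set vs \<noteq> {}" using len by auto
    then have "Max (depth \<phi> ` set vs) \<in> depth \<phi> ` set vs" by simp
    then obtain x where "x \<in> set vs" "Max (depth \<phi> ` set vs) = depth \<phi> x" by auto
    moreover have "depth \<phi> y \<le> Max (depth \<phi> ` set vs)" if "y \<in> set vs" for y
      using that by simp
    ultimately show ?thesis using that by force
  qed
  have nb: "y = \<phi> x" if xy: "{x, y} \<in> uedges ?F" and y: "y \<in> set vs" for y
  proof -
    obtain w where w: "w \<in> uverts G" "\<phi> w \<noteq> w" "{x, y} = {w, \<phi> w}"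
      using xy by (auto simp: forest_of_def)
    then have "w = y \<Longrightarrow> depth \<phi> y > depth \<phi> x"
      using depth_step[OF assms w(1,2)] by (auto simp: doubleton_eq_iff)
    then show ?thesis using w(3) xmax[OF y] by (auto simp: doubleton_eq_iff)
  qed
  obtain i where i: "i < ?l" "vs ! i = x" using x by (auto simp: in_set_conv_nth)
  define j where "j = Suc i mod ?l"
  define h where "h = (if i = 0 then ?l - 1 else i - 1)"
  have j: "j < ?l" unfolding j_def using len by (intro mod_less_divisor) linarith
  have h: "h < ?l" using len i by (auto simp: h_def)
  have "Suc h mod ?l = i" using i len by (auto simp: h_def)
  then have "{x, vs ! h} \<in> uedges ?F" using edges[OF h] i by (simp add: insert_commute)
  then have "vs ! h = \<phi> x" using nb h by simp
  moreover have "vs ! j = \<phi> x" using nb edges[OF i(1)] i j by (simp add: j_def)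
  ultimately have "h = j" using dist h j by (metis nth_eq_iff_index_eq)
  moreover have "h \<noteq> j"
  proof (cases "Suc i = ?l")
    case True
    then show ?thesis using len by (auto simp: h_def j_def)
  next
    case False
    then show ?thesis using len i by (auto simp: h_def j_def)
  qed
  ultimately show False by simp
qed

text \<open>Every edge joins a vertex to its parent, which has the same root. Together with
  the next lemma this makes \<open>root_of \<phi> v\<close> the only root in the component of \<open>v\<close>.\<close>

lemma root_of_constant_on_components:
  assumes "\<phi> \<in> parent_maps G"
    and "(u, v) \<in> (edge_rel (fst (forest_of G \<phi>)))\<^sup>*"
  shows "root_of \<phi> u = root_of \<phi> v"
  using assms(2)
proof induction
  case (step x y)
  obtain w where "w \<in> uverts G" "{x, y} = {w, \<phi> w}"
    using step(2) by (auto simp: edge_rel_def forest_of_def)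
  then show ?case
    using root_of_parent[OF assms(1)] step(3) by (auto simp: doubleton_eq_iff)
qed auto

lemma root_of_connected:
  assumes "simple_ugraph G" "\<phi> \<in> parent_maps G" "v \<in> uverts G"
  shows "root_of \<phi> v \<in> uverts G \<and> \<phi> (root_of \<phi> v) = root_of \<phi> v \<and>
    (v, root_of \<phi> v) \<in> (edge_rel (fst (forest_of G \<phi>)))\<^sup>*"
  using assms
proof (induction rule: parent_maps_induct)
  case (root v)
  then show ?case by (simp add: root_of_fixpoint)
next
  case (parent v)
  have "(v, \<phi> v) \<in> edge_rel (fst (forest_of G \<phi>))"
    using parent by (auto simp: edge_rel_def forest_of_def)
  then show ?case
    using parent root_of_parent[OF assms(2) parent(1)] by (auto intro: converse_rtrancl_into_rtrancl)
qed

lemma forest_of_in_rooted_spanning_forests: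
  assumes "simple_ugraph G" "\<phi> \<in> parent_maps G"
  shows "forest_of G \<phi> \<in> rooted_spanning_forests G"
proof -
  obtain F R where FR: "forest_of G \<phi> = (F, R)" by (cases "forest_of G \<phi>")
  then have F: "F = fst (forest_of G \<phi>)" and R: "R = {v \<in> uverts G. \<phi> v = v}"
    and FV: "uverts F = uverts G"
    by (auto simp: forest_of_def)
  have "spanning_usubgraph F G"
    using parent_maps_edge[OF assms(2)] by (auto simp: F forest_of_def spanning_usubgraph_def)
  moreover have "\<exists>!r. r \<in> C \<inter> R" if C: "C \<in> ucomponents F" for C
  proof -
    obtain v where v: "v \<in> uverts G" "C = {w \<in> uverts G. (v, w) \<in> (edge_rel F)\<^sup>*}"
      using C by (auto simp: ucomponents_eq FV)
    show ?thesis
    proof (rule ex1I)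
      show "root_of \<phi> v \<in> C \<inter> R"
        using root_of_connected[OF assms v(1)] v by (auto simp: F R)
    next
      fix r assume "r \<in> C \<inter> R"
      then show "r = root_of \<phi> v"
        using root_of_constant_on_components[OF assms(2)] v(2)
        by (auto simp: F R root_of_fixpoint)
    qed
  qed
  ultimately show ?thesis
    using forest_of_uacyclic[OF assms(2)]
    unfolding rooted_spanning_forests_def FR by (auto simp: F[symmetric] R FV)
qed

text \<open>The edge from \<open>v\<close> to \<open>\<phi> v\<close> is an edge of both forests, so \<open>\<psi>\<close> uses it in one of
  two directions. The wrong direction \<open>\<psi> (\<phi> v) = v\<close> is excluded by induction from the root:
  the maps already agree at \<open>\<phi> v\<close>, and \<open>\<phi> (\<phi> v) = v\<close> contradicts the depths.\<close>

lemma inj_on_forest_of: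
  assumes "simple_ugraph G"
  shows "inj_on (forest_of G) (parent_maps G)"
proof (rule inj_onI)
  fix \<phi> \<psi>
  assume \<phi>: "\<phi> \<in> parent_maps G" and \<psi>: "\<psi> \<in> parent_maps G"
    and eq: "forest_of G \<phi> = forest_of G \<psi>"
  have same_roots: "\<phi> v = v \<longleftrightarrow> \<psi> v = v" if "v \<in> uverts G" for v
    using eq that by (auto simp: forest_of_def)
  have "\<phi> v = \<psi> v" if "v \<in> uverts G" for v
    using assms \<phi> that
  proof (induction rule: parent_maps_induct)
    case (root v)
    then show ?case using same_roots by simp
  next
    case (parent v)
    have "{v, \<phi> v} \<in> uedges (fst (forest_of G \<psi>))"
      using parent(1,2) unfolding eq[symmetric] by (auto simp: forest_of_def)
    then obtain w where w: "w \<in> uverts G" "\<psi> w \<noteq> w" "{v, \<phi> v} = {w, \<psi> w}"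
      by (simp add: forest_of_def) blast
    show ?case
    proof (cases "w = v")
      case True
      then show ?thesis using w by (auto simp: doubleton_eq_iff)
    next
      case False
      then have "w = \<phi> v" "\<psi> w = v" using w(3) by (auto simp: doubleton_eq_iff)
      then have "\<phi> (\<phi> v) = v" using parent(4) by simp
      then have "depth \<phi> v = Suc (Suc (depth \<phi> v))"
        using depth_step[OF \<phi> parent(1,2)] depth_step[OF \<phi> parent(3)] parent(2) by simp
      then show ?thesis by simp
    qed
  qed
  then show "\<phi> = \<psi>"
    using \<phi> \<psi> by (intro PiE_ext[of _ "uverts G" "\<lambda>v. insert v {w. {v, w} \<in> uedges G}"])
      (auto simp: parent_maps_def)
qed

text \<open>A shortest path that connects the two ends of an edge without using it visits no vertex
  twice, so that the edge closes it to a cycle.\<close>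

lemma ucycle_if_edge_bypassed:
  assumes "\<And>x y. {x, y} \<in> uedges F \<Longrightarrow> x \<in> uverts F" "{u, v} \<in> uedges F" "u \<noteq> v"
    and "(u, v) \<in> {(x, y). {x, y} \<in> uedges F - {{u, v}}}\<^sup>*"
  shows "\<exists>vs. ucycle F vs"
proof -
  define T where "T = {(x, y). {x, y} \<in> uedges F - {{u, v}}}"
  have ex: "\<exists>n. (u, v) \<in> T ^^ n"
    using assms(4) by (simp add: T_def rtrancl_power)
  define n where "n = (LEAST n. (u, v) \<in> T ^^ n)"
  have n: "(u, v) \<in> T ^^ n" unfolding n_def by (rule LeastI_ex[OF ex])
  have nmin: "n \<le> k" if "(u, v) \<in> T ^^ k" for k
    unfolding n_def using that by (rule Least_le)
  obtain f where f: "f 0 = u" "f n = v" "\<And>i. i < n \<Longrightarrow> (f i, f (Suc i)) \<in> T"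
    using n by (auto simp: relpow_fun_conv)
  have seg: "(f i, f (i + k)) \<in> T ^^ k" if "i + k \<le> n" for i k
    using that f(3) by (auto simp: relpow_fun_conv intro!: exI[of _ "\<lambda>j. f (i + j)"])
  have inj: "f i \<noteq> f j" if "i < j" "j \<le> n" for i j
  proof
    assume e: "f i = f j"
    have "(u, f i) \<in> T ^^ i" using seg[of 0 i] that f(1) by simp
    moreover have "(f i, v) \<in> T ^^ (n - j)" using seg[of j "n - j"] that f(2) e by simp
    ultimately have "(u, v) \<in> T ^^ (i + (n - j))" by (auto simp: relpow_add)
    from nmin[OF this] that show False by simp
  qed
  have n2: "2 \<le> n"
  proof (rule ccontr)
    assume "\<not> 2 \<le> n"
    then consider "n = 0" | "n = 1" by linarith
    then show False
    proof cases
      case 1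
      then show ?thesis using f assms(3) by simp
    next
      case 2
      then show ?thesis using f(1,2) f(3)[of 0] by (simp add: T_def)
    qed
  qed
  let ?vs = "map f [0..<Suc n]"
  have nth: "?vs ! i = f i" if "i \<le> n" for i using that by (simp del: upt_Suc)
  have fe: "{f i, f (Suc i)} \<in> uedges F" if "i < n" for i
    using f(3)[OF that] by (simp add: T_def)
  have fv: "f i \<in> uverts F" if "i \<le> n" for i
  proof (cases "i = n")
    case True
    then show ?thesis using assms(1)[of v u] assms(2) f(2) by (simp add: insert_commute)
  next
    case False
    then show ?thesis using assms(1)[OF fe[of i]] that by simp
  qed
  have "distinct ?vs"
    unfolding distinct_conv_nth
  proof (intro allI impI)
    fix i j assume "i < length ?vs" "j < length ?vs" "i \<noteq> j"
    then show "?vs ! i \<noteq> ?vs ! j"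
      using inj[of i j] inj[of j i] by (cases "i < j") (auto simp: nth simp del: upt_Suc)
  qed
  moreover have "{?vs ! i, ?vs ! (Suc i mod length ?vs)} \<in> uedges F" if "i < length ?vs" for i
  proof (cases "i = n")
    case True
    then show ?thesis using assms(2) f(1,2) nth[of n] nth[of 0]
      by (simp add: insert_commute del: upt_Suc)
  next
    case False
    then show ?thesis using that fe[of i] nth[of i] nth[of "Suc i"] by (simp del: upt_Suc)
  qed
  moreover have "set ?vs \<subseteq> uverts F" using fv by (auto simp del: upt_Suc)
  ultimately show ?thesis using n2 unfolding ucycle_def by (intro exI[of _ ?vs]) (simp del: upt_Suc)
qed

text \<open>The parent of a vertex is a neighbour in the forest that is closer to the root. An edge
  not arising in this way would be bypassed by the paths from its two ends to their common
  root, and so would lie on a cycle.\<close>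

lemma rooted_spanning_forest_parent_map:
  assumes G: "simple_ugraph G" and FR: "(F, R) \<in> rooted_spanning_forests G"
  obtains \<phi> where "\<phi> \<in> parent_maps G" "forest_of G \<phi> = (F, R)"
proof -
  let ?V = "uverts G"
  let ?E = "edge_rel F"
  have FV: "uverts F = ?V" and FE: "uedges F \<subseteq> uedges G" and acyc: "\<nexists>vs. ucycle F vs"
    and RV: "R \<subseteq> ?V" and one: "\<And>C. C \<in> ucomponents F \<Longrightarrow> \<exists>!r. r \<in> C \<inter> R"
    using FR by (auto simp: rooted_spanning_forests_def spanning_usubgraph_def uacyclic_def)
  have edgeD: "x \<in> ?V" "y \<in> ?V" "x \<noteq> y" if "{x, y} \<in> uedges F" for x y
    using simple_ugraph_edgeD[OF G] that FE by blast+
  have root: "\<exists>!r. r \<in> R \<and> (v, r) \<in> ?E\<^sup>*" if "v \<in> ?V" for v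
  proof -
    have "{w \<in> ?V. (v, w) \<in> ?E\<^sup>*} \<in> ucomponents F" using that by (auto simp: ucomponents_eq FV)
    from one[OF this] show ?thesis using RV by (auto 0 3)
  qed
  define d where "d v = (LEAST n. \<exists>r\<in>R. (v, r) \<in> ?E ^^ n)" for v
  have d_ex: "\<exists>r\<in>R. (v, r) \<in> ?E ^^ d v" if "v \<in> ?V" for v
    unfolding d_def
  proof (rule LeastI_ex)
    show "\<exists>n. \<exists>r\<in>R. (v, r) \<in> ?E ^^ n"
      using root[OF that] by (auto simp: rtrancl_power)
  qed
  have d_le: "d v \<le> n" if "r \<in> R" "(v, r) \<in> ?E ^^ n" for v r n
    unfolding d_def using that by (intro Least_le) auto
  have step: "\<exists>w. (v, w) \<in> ?E \<and> d v = Suc (d w)" if v: "v \<in> ?V" "v \<notin> R" for v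
  proof -
    obtain r where r: "r \<in> R" "(v, r) \<in> ?E ^^ d v" using d_ex[OF v(1)] by auto
    then have "d v \<noteq> 0" using v by (cases "d v = 0") auto
    then obtain n where n: "d v = Suc n" by (cases "d v") auto
    then obtain w where w: "(v, w) \<in> ?E" "(w, r) \<in> ?E ^^ n"
      using r by (metis relpow_Suc_D2)
    then have wV: "w \<in> ?V" using edgeD(2) by (auto simp: edge_rel_def)
    obtain r' where r': "r' \<in> R" "(w, r') \<in> ?E ^^ d w" using d_ex[OF wV] by auto
    then have "(v, r') \<in> ?E ^^ Suc (d w)" using w(1) by (meson relpow_Suc_I2)
    then have "d v \<le> Suc (d w)" using d_le r' by blast
    moreover have "d w \<le> n" using d_le w r by blast
    ultimately show ?thesis using n w by auto
  qed
  define \<phi> where "\<phi> = (\<lambda>v\<in>?V. if v \<in> R then v else SOME w. (v, w) \<in> ?E \<and> d v = Suc (d w))"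
  have \<phi>R: "\<phi> v = v" if "v \<in> R" for v using that RV by (auto simp: \<phi>_def)
  have \<phi>E: "(v, \<phi> v) \<in> ?E" "d v = Suc (d (\<phi> v))" if "v \<in> ?V" "v \<notin> R" for v
    using someI_ex[OF step[OF that]] that by (auto simp: \<phi>_def)
  have \<phi>V: "\<phi> v \<in> ?V" if "v \<in> ?V" for v
    using \<phi>R[of v] \<phi>E(1)[of v] that edgeD(2)[of v "\<phi> v"]
    by (cases "v \<in> R") (auto simp: edge_rel_def)
  have \<phi>fix: "\<phi> v = v \<longleftrightarrow> v \<in> R" if "v \<in> ?V" for v
    using \<phi>R[of v] \<phi>E(2)[OF that] by fastforce
  have "\<exists>k. \<phi> ((\<phi> ^^ k) v) = (\<phi> ^^ k) v" if "v \<in> ?V" for v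
    using that
  proof (induction "d v" arbitrary: v rule: less_induct)
    case less
    show ?case
    proof (cases "v \<in> R")
      case True
      then show ?thesis using \<phi>R by (intro exI[of _ 0]) simp
    next
      case False
      then obtain k where "\<phi> ((\<phi> ^^ k) (\<phi> v)) = (\<phi> ^^ k) (\<phi> v)"
        using less.hyps[of "\<phi> v"] \<phi>E(2) \<phi>V less.prems by auto
      then show ?thesis by (intro exI[of _ "Suc k"]) (simp add: funpow_swap1)
    qed
  qed
  moreover have "\<phi> v \<in> insert v {w. {v, w} \<in> uedges G}" if "v \<in> ?V" for v
    using \<phi>R[of v] \<phi>E(1)[OF that] FE by (cases "v \<in> R") (auto simp: edge_rel_def)
  moreover have "\<phi> \<in> extensional ?V" by (auto simp: \<phi>_def)
  ultimately have "\<phi> \<in> parent_maps G" by (auto simp: parent_maps_def PiE_iff)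
  moreover have "forest_of G \<phi> = (F, R)"
  proof -
    have "{{v, \<phi> v} | v. v \<in> ?V \<and> \<phi> v \<noteq> v} = uedges F"
    proof (intro equalityI subsetI)
      fix e assume "e \<in> {{v, \<phi> v} | v. v \<in> ?V \<and> \<phi> v \<noteq> v}"
      then show "e \<in> uedges F" using \<phi>fix \<phi>E(1) by (auto simp: edge_rel_def)
    next
      fix e assume e: "e \<in> uedges F"
      then have "card e = 2" using FE G by (auto simp: simple_ugraph_def)
      then obtain u v where uv: "e = {u, v}" "u \<noteq> v" by (auto simp: card_2_iff)
      have V: "u \<in> ?V" "v \<in> ?V" using edgeD e uv by auto
      show "e \<in> {{v, \<phi> v} | v. v \<in> ?V \<and> \<phi> v \<noteq> v}"
      proof (rule ccontr)
        assume not: "e \<notin> {{v, \<phi> v} | v. v \<in> ?V \<and> \<phi> v \<noteq> v}"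
        (* By assumption no parent edge is the edge uv, so the paths to the roots stay in ?T. *)
        let ?T = "{(x, y). {x, y} \<in> uedges F - {{u, v}}}"
        have to_root: "\<exists>r\<in>R. (x, r) \<in> ?T\<^sup>*" if "x \<in> ?V" for x
          using that
        proof (induction "d x" arbitrary: x rule: less_induct)
          case less
          show ?case
          proof (cases "x \<in> R")
            case False
            then obtain r where "r \<in> R" "(\<phi> x, r) \<in> ?T\<^sup>*"
              using less.hyps[of "\<phi> x"] \<phi>E(2) \<phi>V less.prems by auto
            moreover have "(x, \<phi> x) \<in> ?T"
              using \<phi>E(1)[OF less.prems False] not \<phi>fix[OF less.prems] False less.prems uv(1)
              by (auto simp: edge_rel_def)
            ultimately show ?thesis by (meson converse_rtrancl_into_rtrancl)
          qed auto
        qed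
        have TE: "?T \<subseteq> ?E" by (auto simp: edge_rel_def)
        obtain r where r: "r \<in> R" "(u, r) \<in> ?T\<^sup>*" using to_root V by blast
        obtain r' where r': "r' \<in> R" "(v, r') \<in> ?T\<^sup>*" using to_root V by blast
        have "(u, v) \<in> ?E" using e uv by (simp add: edge_rel_def)
        then have "(u, r') \<in> ?E\<^sup>*"
          using r'(2) rtrancl_mono[OF TE] by (meson converse_rtrancl_into_rtrancl subsetD)
        moreover have "(u, r) \<in> ?E\<^sup>*" using r(2) rtrancl_mono[OF TE] by blast
        ultimately have "r = r'" using root[OF V(1)] r(1) r'(1) by blast
        moreover have "sym ?T" by (auto simp: sym_def insert_commute)
        ultimately have "(r, v) \<in> ?T\<^sup>*"
          using symD[OF sym_rtrancl r'(2)] by simp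
        with r(2) have "(u, v) \<in> ?T\<^sup>*" by (rule rtrancl_trans)
        with ucycle_if_edge_bypassed[of F u v] edgeD FV e uv acyc show False by auto
      qed
    qed
    moreover have "{v \<in> ?V. \<phi> v = v} = R" using \<phi>fix RV by auto
    ultimately show ?thesis by (simp add: forest_of_def FV[symmetric])
  qed
  ultimately show ?thesis using that by blast
qed

theorem bij_betw_forest_of:
  assumes "simple_ugraph G"
  shows "bij_betw (forest_of G) (parent_maps G) (rooted_spanning_forests G)"
  unfolding bij_betw_def
proof
  show "forest_of G ` parent_maps G = rooted_spanning_forests G"
  proof (intro equalityI subsetI)
    fix X assume "X \<in> rooted_spanning_forests G"
    then show "X \<in> forest_of G ` parent_maps G"
      using rooted_spanning_forest_parent_map[OF assms] by (metis image_iff surj_pair)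
  qed (auto intro: forest_of_in_rooted_spanning_forests[OF assms])
qed (rule inj_on_forest_of[OF assms])

section \<open>The matrix forest theorem\<close>

text \<open>The identity plus the Laplacian.\<close>

definition forest_matrix :: "nat \<Rightarrow> nat ugraph \<Rightarrow> int mat" where
  "forest_matrix n G = mat n n (\<lambda>(i, j).
     if i = j then 1 + int (card {w. {i, w} \<in> uedges G})
     else if {i, j} \<in> uedges G then - 1 else 0)"

text \<open>The \<open>i\<close>-th row contributed by the choice of \<open>w\<close> as parent of \<open>i\<close>: the unit vector \<open>e\<^sub>i\<close> if
  \<open>i\<close> is to be a root (\<open>w = i\<close>), and \<open>e\<^sub>i - e\<^sub>w\<close> otherwise.\<close>

definition parent_row :: "nat \<Rightarrow> nat \<Rightarrow> nat \<Rightarrow> int" where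
  "parent_row i w j = of_bool (i = j) - of_bool (w \<noteq> i \<and> j = w)"

definition parent_matrix :: "nat \<Rightarrow> (nat \<Rightarrow> nat) \<Rightarrow> int mat" where
  "parent_matrix n \<phi> = mat n n (\<lambda>(i, j). parent_row i (\<phi> i) j)"

lemma forest_matrix_carrier [simp]: "forest_matrix n G \<in> carrier_mat n n"
  by (simp add: forest_matrix_def)

lemma parent_matrix_carrier [simp]: "parent_matrix n \<phi> \<in> carrier_mat n n"
  by (simp add: parent_matrix_def)

lemma finite_neighbours:
  assumes "simple_ugraph G"
  shows "finite {w. {v, w} \<in> uedges G}"
proof (rule finite_subset)
  show "{w. {v, w} \<in> uedges G} \<subseteq> uverts G" using simple_ugraph_edgeD(2)[OF assms] by auto
  show "finite (uverts G)" using assms by (simp add: simple_ugraph_def)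
qed

text \<open>Only the identity contributes to the Leibniz expansion. A permutation \<open>\<pi>\<close> with nonzero
  contribution has \<open>\<pi> v \<in> {v, \<phi> v}\<close> for all \<open>v\<close>; hence it fixes the roots, and if it fixes
  \<open>\<phi> v\<close>, injectivity forces it to fix \<open>v\<close> as well.\<close>

lemma det_parent_matrix_forest:
  assumes "simple_ugraph G" "uverts G = {0..<n}" "\<phi> \<in> parent_maps G"
  shows "det (parent_matrix n \<phi>) = 1"
proof -
  have only_id: "(\<Prod>i = 0..<n. parent_matrix n \<phi> $$ (i, \<pi> i)) = of_bool (\<pi> = id)"
    if \<pi>: "\<pi> permutes {0..<n}" for \<pi>
  proof (cases "\<pi> = id")
    case True
    have "(\<Prod>i = 0..<n. parent_matrix n \<phi> $$ (i, i)) = 1"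
      by (intro prod.neutral) (auto simp: parent_matrix_def parent_row_def)
    then show ?thesis using True by simp
  next
    case False
    have "\<exists>i\<in>{0..<n}. \<pi> i \<noteq> i \<and> \<pi> i \<noteq> \<phi> i"
    proof (rule ccontr)
      assume none: "\<not> ?thesis"
      have "\<pi> v = v" if v: "v \<in> uverts G" for v
        using assms(1,3) v
      proof (induction rule: parent_maps_induct)
        case (root v)
        then show ?case using none assms(2) by auto
      next
        case (parent v)
        show ?case
        proof (rule ccontr)
          assume "\<pi> v \<noteq> v"
          then have "\<pi> v = \<pi> (\<phi> v)" using none parent assms(2) by auto
          then show False using permutes_inj[OF \<pi>] parent(2) by (metis injD)
        qed
      qed
      then have "\<pi> = id"
        using permutes_not_in[OF \<pi>] assms(2) by (metis eq_id_iff)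
      then show False using False by simp
    qed
    then obtain i where i: "i < n" "\<pi> i \<noteq> i" "\<pi> i \<noteq> \<phi> i" by auto
    moreover have "\<pi> i < n" using permutes_in_image[OF \<pi>, of i] i(1) by simp
    ultimately have "parent_matrix n \<phi> $$ (i, \<pi> i) = 0"
      by (auto simp: parent_matrix_def parent_row_def)
    then show ?thesis using i(1) False by (auto intro!: prod_zero bexI[of _ i])
  qed
  have "det (parent_matrix n \<phi>) =
      (\<Sum>\<pi>\<in>{\<pi>. \<pi> permutes {0..<n}}. signof \<pi> * of_bool (\<pi> = id))"
    unfolding det_def'[OF parent_matrix_carrier] using only_id by (intro sum.cong) auto
  also have "\<dots> = (\<Sum>\<pi>\<in>{id}. signof \<pi> * of_bool (\<pi> = id))"
    by (rule sum.mono_neutral_right) (auto simp: finite_permutations permutes_id)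
  finally show ?thesis by simp
qed

text \<open>The indicator function of the vertices that never reach a root lies in the kernel: a
  vertex and its parent either both reach a root or both do not.\<close>

lemma det_parent_matrix_cycle:
  assumes maps: "\<And>v. v < n \<Longrightarrow> \<phi> v < n"
    and i0: "i0 < n" "\<nexists>k. \<phi> ((\<phi> ^^ k) i0) = (\<phi> ^^ k) i0"
  shows "det (parent_matrix n \<phi>) = 0"
proof -
  define rooted where "rooted i \<longleftrightarrow> (\<exists>k. \<phi> ((\<phi> ^^ k) i) = (\<phi> ^^ k) i)" for i
  have rooted_fix: "rooted i" if "\<phi> i = i" for i
    unfolding rooted_def using that by (intro exI[of _ 0]) simp
  have rooted_step: "rooted (\<phi> i) \<longleftrightarrow> rooted i" if nofix: "\<phi> i \<noteq> i" for i
  proof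
    assume "rooted (\<phi> i)"
    then obtain k where "\<phi> ((\<phi> ^^ k) (\<phi> i)) = (\<phi> ^^ k) (\<phi> i)" by (auto simp: rooted_def)
    then show "rooted i" unfolding rooted_def by (intro exI[of _ "Suc k"]) (simp add: funpow_swap1)
  next
    assume "rooted i"
    then obtain k where k: "\<phi> ((\<phi> ^^ k) i) = (\<phi> ^^ k) i" by (auto simp: rooted_def)
    then obtain l where "k = Suc l" using nofix by (cases k) auto
    then show "rooted (\<phi> i)" using k unfolding rooted_def
      by (intro exI[of _ l]) (simp add: funpow_swap1)
  qed
  define y :: "nat \<Rightarrow> int" where "y i = (if rooted i then 0 else 1)" for i
  define x :: "int vec" where "x = vec n y"
  have "parent_matrix n \<phi> *\<^sub>v x = 0\<^sub>v n"
  proof (rule eq_vecI)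
    fix i assume "i < dim_vec (0\<^sub>v n :: int vec)"
    then have i: "i < n" by simp
    have "(parent_matrix n \<phi> *\<^sub>v x) $ i = (\<Sum>j = 0..<n. parent_row i (\<phi> i) j * y j)"
      using i by (simp add: parent_matrix_def x_def scalar_prod_def)
    also have "\<dots> = (\<Sum>j = 0..<n. (if j = i then y i else 0)
        - (if j = \<phi> i then if \<phi> i \<noteq> i then y (\<phi> i) else 0 else 0))"
      by (intro sum.cong) (auto simp: parent_row_def)
    also have "\<dots> = y i - (if \<phi> i \<noteq> i then y (\<phi> i) else 0)"
      using i maps[OF i] by (simp add: sum_subtractf)
    also have "\<dots> = 0"
      using rooted_fix[of i] rooted_step[of i] by (auto simp: y_def)
    finally show "(parent_matrix n \<phi> *\<^sub>v x) $ i = 0\<^sub>v n $ i"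
      using i by simp
  qed (simp add: parent_matrix_def)
  moreover have "x $ i0 \<noteq> 0\<^sub>v n $ i0" using i0 by (simp add: x_def y_def rooted_def)
  then have "x \<noteq> 0\<^sub>v n" by auto
  moreover have "x \<in> carrier_vec n" by (simp add: x_def)
  ultimately show ?thesis
    using det_0_iff_vec_prod_zero[OF parent_matrix_carrier] by blast
qed

lemma forest_matrix_row:
  assumes "simple_ugraph G" "i < n" "j < n"
  shows "forest_matrix n G $$ (i, j) = (\<Sum>w\<in>insert i {w. {i, w} \<in> uedges G}. parent_row i w j)"
proof -
  let ?N = "{w. {i, w} \<in> uedges G}"
  have fin: "finite ?N" by (rule finite_neighbours[OF assms(1)])
  have irr: "i \<notin> ?N" using simple_ugraph_edgeD(3)[OF assms(1)] by blast
  have "(\<Sum>w\<in>?N. parent_row i w j) = (\<Sum>w\<in>?N. of_bool (i = j) - of_bool (j = w))"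
    using irr by (intro sum.cong) (auto simp: parent_row_def)
  also have "\<dots> = int (card ?N) * of_bool (i = j) - of_bool (j \<in> ?N)"
    using fin by (simp add: sum_subtractf of_bool_def)
  finally show ?thesis
    using assms(2,3) fin irr by (auto simp: forest_matrix_def parent_row_def)
qed

theorem matrix_forest_theorem:
  assumes G: "simple_ugraph G" and V: "uverts G = {0..<n}"
  shows "int (card (rooted_spanning_forests G)) = det (forest_matrix n G)"
proof -
  let ?N = "\<lambda>i. insert i {w. {i, w} \<in> uedges G}"
  let ?P = "{\<pi>. \<pi> permutes {0..<n}}"
  let ?M = "\<Pi>\<^sub>E i\<in>{0..<n}. ?N i"
  have finN: "finite (?N i)" for i using finite_neighbours[OF G] by simp
  have finM: "finite ?M" using finN by (intro finite_PiE) auto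
  have "det (forest_matrix n G) =
      (\<Sum>\<pi>\<in>?P. signof \<pi> * (\<Prod>i = 0..<n. \<Sum>w\<in>?N i. parent_row i w (\<pi> i)))"
    unfolding det_def'[OF forest_matrix_carrier]
  proof (intro sum.cong refl arg_cong2[of _ _ _ _ "(*)"] prod.cong)
    fix \<pi> i assume "\<pi> \<in> ?P" "i \<in> {0..<n}"
    then show "forest_matrix n G $$ (i, \<pi> i) = (\<Sum>w\<in>?N i. parent_row i w (\<pi> i))"
      using permutes_in_image[of \<pi> "{0..<n}" i] by (intro forest_matrix_row[OF G]) auto
  qed
  also have "\<dots> = (\<Sum>\<pi>\<in>?P. \<Sum>\<phi>\<in>?M. signof \<pi> * (\<Prod>i = 0..<n. parent_row i (\<phi> i) (\<pi> i)))"
    using finN by (simp only: prod_sum_PiE[OF finite_atLeastLessThan] sum_distrib_left)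
  also have "\<dots> = (\<Sum>\<phi>\<in>?M. \<Sum>\<pi>\<in>?P. signof \<pi> * (\<Prod>i = 0..<n. parent_row i (\<phi> i) (\<pi> i)))"
    by (rule sum.swap)
  also have "\<dots> = (\<Sum>\<phi>\<in>?M. det (parent_matrix n \<phi>))"
    unfolding det_def'[OF parent_matrix_carrier]
  proof (intro sum.cong refl arg_cong2[of _ _ _ _ "(*)"] prod.cong)
    fix \<phi> \<pi> i assume "\<pi> \<in> ?P" "i \<in> {0..<n}"
    then show "parent_row i (\<phi> i) (\<pi> i) = parent_matrix n \<phi> $$ (i, \<pi> i)"
      using permutes_in_image[of \<pi> "{0..<n}" i] by (simp add: parent_matrix_def)
  qed
  also have "\<dots> = (\<Sum>\<phi>\<in>?M. of_bool (\<phi> \<in> parent_maps G))"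
  proof (intro sum.cong refl)
    fix \<phi> assume \<phi>: "\<phi> \<in> ?M"
    show "det (parent_matrix n \<phi>) = of_bool (\<phi> \<in> parent_maps G)"
    proof (cases "\<phi> \<in> parent_maps G")
      case True
      then show ?thesis using det_parent_matrix_forest[OF G V] by simp
    next
      case False
      then obtain v where "v < n" "\<nexists>k. \<phi> ((\<phi> ^^ k) v) = (\<phi> ^^ k) v"
        using \<phi> by (auto simp: parent_maps_def V)
      moreover have "\<phi> v < n" if "v < n" for v
      proof -
        have "\<phi> v \<in> ?N v" using \<phi> that by (auto simp: PiE_iff)
        then show ?thesis using that simple_ugraph_edgeD(2)[OF G, of v "\<phi> v"] V by auto
      qed
      ultimately show ?thesis using False det_parent_matrix_cycle[of n \<phi> v] by simp
    qed
  qed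
  also have "\<dots> = int (card (?M \<inter> parent_maps G))"
    using finM by (simp add: of_bool_def sum.If_cases Int_def)
  also have "?M \<inter> parent_maps G = parent_maps G" by (auto simp: parent_maps_def V)
  also have "card (parent_maps G) = card (rooted_spanning_forests G)"
    by (rule bij_betw_same_card[OF bij_betw_forest_of[OF G]])
  finally show ?thesis by simp
qed

section \<open>The forest operator on periodic functions\<close>

text \<open>The action of \<open>I + L\<close> on functions on the cyclic group of order \<open>n\<close>, read as periodic
  functions on the integers. The integers as domain make translations and reflections visible
  without reductions modulo \<open>n\<close>.\<close>

definition forest_op :: "nat set \<Rightarrow> (int \<Rightarrow> int) \<Rightarrow> int \<Rightarrow> int" where
  "forest_op S x l = x l + (\<Sum>t\<in>S. 2 * x l - x (l + int t) - x (l - int t))"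

definition periodic :: "nat \<Rightarrow> (int \<Rightarrow> int) \<Rightarrow> bool" where
  "periodic n x \<longleftrightarrow> (\<forall>l. x (l + int n) = x l)"

definition odd_fun :: "(int \<Rightarrow> int) \<Rightarrow> bool" where
  "odd_fun x \<longleftrightarrow> (\<forall>l. x (- l) = - x l)"

lemma periodic_cong:
  assumes "periodic n x" "[a = b] (mod int n)"
  shows "x a = x b"
proof -
  have nat_shift: "x (l + int n * int k) = x l" for l k
  proof (induction k)
    case (Suc k)
    have "x (l + int n * int (Suc k)) = x ((l + int n * int k) + int n)"
      by (simp add: algebra_simps)
    then show ?case using assms(1) Suc by (simp add: periodic_def)
  qed simp
  obtain k where k: "a = b + int n * k"
    using assms(2) by (metis cong_iff_lin cong_sym)
  show ?thesis
  proof (cases "k \<ge> 0")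
    case True
    then show ?thesis using nat_shift[of b "nat k"] k by simp
  next
    case False
    then show ?thesis using nat_shift[of a "nat (- k)"] k by simp
  qed
qed

lemma periodic_mod: "periodic n x \<Longrightarrow> x (l mod int n) = x l"
  by (rule periodic_cong) (auto simp: cong_def)

lemma cong_add_iff_diff: "[a = b + t] (mod m) \<longleftrightarrow> [b = a - t] (mod m)" for a b t m :: int
  by (metis add_diff_cancel_right' cong_add_rcancel cong_sym_eq diff_add_cancel)

lemma circulant_edge_iff:
  "{i, w} \<in> uedges (circulant_graph n S) \<longleftrightarrow>
     i < n \<and> w < n \<and>
     (\<exists>t\<in>S. [int w = int i + int t] (mod int n) \<or> [int w = int i - int t] (mod int n))"
  (is "?L \<longleftrightarrow> ?R i w")
proof
  assume ?L
  then obtain i' w' where R: "?R i' w'" and eq: "{i, w} = {i', w'}"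
    by (auto simp: circulant_graph_def)
  have "?R w' i'" using R cong_add_iff_diff[of "int w'" "int i'" _ "int n"]
      cong_add_iff_diff[of "int i'" "int w'" _ "int n"]
    by blast
  with R eq show "?R i w" by (auto simp: doubleton_eq_iff)
qed (auto simp: circulant_graph_def)

lemma int_dvd_abs_less_imp_zero: "c = 0" if "int n dvd c" "\<bar>c\<bar> < int n"
  using dvd_imp_le_int[of c "int n"] that by force

text \<open>The residues \<open>i + t\<close> and \<open>i - t\<close> for jumps \<open>t\<close> below \<open>n / 2\<close> are pairwise distinct, so each
  neighbour is counted once.\<close>

lemma sum_circulant_neighbours:
  fixes h :: "nat \<Rightarrow> int"
  assumes S: "finite S" "\<And>t. t \<in> S \<Longrightarrow> 1 \<le> t \<and> 2 * t < n" and i: "i < n"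
  shows "(\<Sum>w\<in>{w. {i, w} \<in> uedges (circulant_graph n S)}. h w) =
    (\<Sum>t\<in>S. h (nat ((int i + int t) mod int n)) + h (nat ((int i - int t) mod int n)))"
proof -
  define up where "up t = nat ((int i + int t) mod int n)" for t
  define dn where "dn t = nat ((int i - int t) mod int n)" for t
  have n: "n > 0" using i by simp
  have int_up: "int (up t) = (int i + int t) mod int n"
    and int_dn: "int (dn t) = (int i - int t) mod int n" for t
    using n by (simp_all add: up_def dn_def)
  have residue: "w < n \<and> [int w = a] (mod int n) \<longleftrightarrow> int w = a mod int n" for w a
  proof -
    have "a mod int n < int n" using n by simp
    then show ?thesis by (auto simp: cong_def simp del: pos_mod_bound)
  qed
  have nb: "{w. {i, w} \<in> uedges (circulant_graph n S)} = up ` S \<union> dn ` S"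
  proof (intro equalityI subsetI)
    fix w assume "w \<in> {w. {i, w} \<in> uedges (circulant_graph n S)}"
    then obtain t where "t \<in> S" "int w = (int i + int t) mod int n \<or> int w = (int i - int t) mod int n"
      unfolding mem_Collect_eq circulant_edge_iff using residue by blast
    then show "w \<in> up ` S \<union> dn ` S" unfolding int_up[symmetric] int_dn[symmetric] by auto
  next
    fix w assume "w \<in> up ` S \<union> dn ` S"
    then obtain t where "t \<in> S" "int w = (int i + int t) mod int n \<or> int w = (int i - int t) mod int n"
      using int_up int_dn by blast
    then show "w \<in> {w. {i, w} \<in> uedges (circulant_graph n S)}"
      unfolding mem_Collect_eq circulant_edge_iff using residue i by blast
  qed
  have "inj_on up S"
  proof (rule inj_onI)
    fix t t' assume t: "t \<in> S" "t' \<in> S" "up t = up t'"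
    then have "(int i + int t) mod int n = (int i + int t') mod int n" using int_up by metis
    then have "int n dvd (int i + int t) - (int i + int t')" by (simp only: mod_eq_dvd_iff)
    then have "int n dvd int t - int t'" by simp
    moreover have "\<bar>int t - int t'\<bar> < int n" using S(2)[OF t(1)] S(2)[OF t(2)] by linarith
    ultimately have "int t - int t' = 0" by (rule int_dvd_abs_less_imp_zero)
    then show "t = t'" by simp
  qed
  moreover have "inj_on dn S"
  proof (rule inj_onI)
    fix t t' assume t: "t \<in> S" "t' \<in> S" "dn t = dn t'"
    then have "(int i - int t) mod int n = (int i - int t') mod int n" using int_dn by metis
    then have "int n dvd (int i - int t) - (int i - int t')" by (simp only: mod_eq_dvd_iff)
    then have "int n dvd int t' - int t" by simp
    moreover have "\<bar>int t' - int t\<bar> < int n" using S(2)[OF t(1)] S(2)[OF t(2)] by linarith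
    ultimately have "int t' - int t = 0" by (rule int_dvd_abs_less_imp_zero)
    then show "t = t'" by simp
  qed
  moreover have "up ` S \<inter> dn ` S = {}"
  proof (rule ccontr)
    assume "up ` S \<inter> dn ` S \<noteq> {}"
    then obtain t t' where t: "t \<in> S" "t' \<in> S" "up t = dn t'" by auto
    then have "(int i + int t) mod int n = (int i - int t') mod int n"
      using int_up int_dn by metis
    then have "int n dvd (int i + int t) - (int i - int t')" by (simp only: mod_eq_dvd_iff)
    then have "int n dvd int t + int t'" by simp
    moreover have "\<bar>int t + int t'\<bar> < int n" using S(2)[OF t(1)] S(2)[OF t(2)] by linarith
    ultimately have "int t + int t' = 0" by (rule int_dvd_abs_less_imp_zero)
    then show False using S(2)[OF t(1)] by simp
  qed
  ultimately show ?thesis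
    unfolding nb using S(1)
    by (simp add: sum.union_disjoint sum.reindex sum.distrib up_def[symmetric] dn_def[symmetric])
qed

lemma forest_matrix_mult_periodic:
  assumes S: "finite S" "\<And>t. t \<in> S \<Longrightarrow> 1 \<le> t \<and> 2 * t < n" and i: "i < n"
    and x: "periodic n x"
  shows "(\<Sum>j = 0..<n. forest_matrix n (circulant_graph n S) $$ (i, j) * x (int j))
    = forest_op S x (int i)"
proof -
  let ?N = "{w. {i, w} \<in> uedges (circulant_graph n S)}"
  have simple: "simple_ugraph (circulant_graph n S)"
    using S(2) by (intro simple_circulant_graph) (meson less_imp_le)
  have N: "?N \<subseteq> {0..<n}" by (auto simp: circulant_edge_iff)
  have irr: "i \<notin> ?N" using simple_ugraph_edgeD(3)[OF simple] by blast
  have "int (card ?N) = (\<Sum>w\<in>?N. 1)" by simp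
  also have "\<dots> = 2 * int (card S)"
    using sum_circulant_neighbours[OF S i, of "\<lambda>_. 1"] by simp
  finally have deg: "int (card ?N) = 2 * int (card S)" .
  have "(\<Sum>j = 0..<n. forest_matrix n (circulant_graph n S) $$ (i, j) * x (int j)) =
      (\<Sum>j = 0..<n. (if j = i then (1 + int (card ?N)) * x (int i) else 0)
         - (if j \<in> ?N then x (int j) else 0))"
    using i irr by (intro sum.cong) (auto simp: forest_matrix_def)
  also have "\<dots> = (1 + 2 * int (card S)) * x (int i) - (\<Sum>j\<in>?N. x (int j))"
    using i N deg by (simp add: sum_subtractf sum.If_cases Int_absorb1)
  also have "(\<Sum>j\<in>?N. x (int j)) = (\<Sum>t\<in>S. x (int i + int t) + x (int i - int t))"
    using i by (simp add: sum_circulant_neighbours[OF S i] periodic_mod[OF x])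
  finally show ?thesis
    by (simp add: forest_op_def sum_subtractf sum.distrib algebra_simps)
qed

lemma forest_op_shift: "forest_op S (\<lambda>l. x (l + c)) l = forest_op S x (l + c)"
  by (simp add: forest_op_def algebra_simps)

lemma forest_op_diff: "forest_op S (\<lambda>l. x l - y l) l = forest_op S x l - forest_op S y l"
  by (simp add: forest_op_def algebra_simps sum_subtractf sum.distrib)

lemma forest_op_periodic: "periodic n x \<Longrightarrow> periodic n (forest_op S x)"
  unfolding periodic_def
proof
  fix l assume x: "\<forall>l. x (l + int n) = x l"
  have "(\<lambda>l. x (l + int n)) = x" using x by auto
  then show "forest_op S x (l + int n) = forest_op S x l"
    using forest_op_shift[of S x "int n" l] by simp
qed

lemma forest_op_odd: 
  assumes "odd_fun x"
  shows "odd_fun (forest_op S x)"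
  unfolding odd_fun_def
proof
  fix l
  have neg: "x (- l + c) = - x (l - c)" "x (- l - c) = - x (l + c)" for c
    using assms[unfolded odd_fun_def, rule_format, of "l - c"]
      assms[unfolded odd_fun_def, rule_format, of "l + c"] by simp_all
  have "x (- l) = - x l" using assms by (simp add: odd_fun_def)
  then show "forest_op S x (- l) = - forest_op S x l"
    unfolding forest_op_def neg by (simp add: sum_negf[symmetric] algebra_simps)
qed

definition alternating :: "int \<Rightarrow> int" where
  "alternating l = (if even l then 1 else - 1)"

lemma forest_op_const: "forest_op S (\<lambda>_. 1) l = 1"
  by (simp add: forest_op_def)

text \<open>A jump of even length preserves the sign, while a jump of odd length flips it and
  contributes \<open>2 + 1 + 1 = 4\<close>.\<close>

lemma forest_op_alternating:
  assumes "finite S"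
  shows "forest_op S alternating l = (1 + 4 * int (card {t \<in> S. odd t})) * alternating l"
proof -
  have "(\<Sum>t\<in>S. 2 * alternating l - alternating (l + int t) - alternating (l - int t)) =
      (\<Sum>t\<in>S. if odd t then 4 * alternating l else 0)"
    by (intro sum.cong) (auto simp: alternating_def)
  also have "\<dots> = 4 * int (card {t \<in> S. odd t}) * alternating l"
    using assms by (simp add: sum.If_cases Int_def)
  finally show ?thesis by (simp add: forest_op_def algebra_simps)
qed

section \<open>Odd periodic functions\<close>

text \<open>The antisymmetrised delta function at \<open>j\<close>.\<close>

definition odd_delta :: "nat \<Rightarrow> nat \<Rightarrow> int \<Rightarrow> int" where
  "odd_delta n j l = of_bool (int n dvd l - int j) - of_bool (int n dvd l + int j)"

lemma odd_delta_periodic: "periodic n (odd_delta n j)"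
proof -
  have "int n dvd l + int n - int j \<longleftrightarrow> int n dvd l - int j" for l
    using dvd_add_right_iff[of "int n" "int n" "l - int j"] by (simp add: algebra_simps)
  moreover have "int n dvd l + int n + int j \<longleftrightarrow> int n dvd l + int j" for l
    using dvd_add_right_iff[of "int n" "int n" "l + int j"] by (simp add: algebra_simps)
  ultimately show ?thesis by (simp add: periodic_def odd_delta_def)
qed

lemma odd_delta_odd: "odd_fun (odd_delta n j)"
proof -
  have "int n dvd - l - int j \<longleftrightarrow> int n dvd l + int j" for l
    using dvd_minus_iff[of "int n" "l + int j"] by simp
  moreover have "int n dvd - l + int j \<longleftrightarrow> int n dvd l - int j" for l
    using dvd_minus_iff[of "int n" "l - int j"] by simp
  ultimately show ?thesis by (simp add: odd_fun_def odd_delta_def)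
qed

lemma odd_delta_residue:
  assumes "1 \<le> j" "j < n" "r < n"
  shows "odd_delta n j (int r) = of_bool (r = j) - of_bool (r = n - j)"
proof -
  have "int n dvd int r - int j \<longleftrightarrow> r = j"
  proof
    assume "int n dvd int r - int j"
    moreover have "\<bar>int r - int j\<bar> < int n" using assms by auto
    ultimately have "int r - int j = 0" by (rule int_dvd_abs_less_imp_zero)
    then show "r = j" by simp
  qed simp
  moreover have "int n dvd int r + int j \<longleftrightarrow> r = n - j"
  proof
    assume "int n dvd int r + int j"
    then obtain k where k: "int r + int j = int n * k" by (elim dvdE)
    have pos: "0 < int n * k" "int n * k < int n * 2" using assms k[symmetric] by simp_all
    then have "0 < k" "k < 2" using assms
      by (simp_all add: zero_less_mult_iff)
    then have "k = 1" by simp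
    then show "r = n - j" using k by simp
  next
    assume "r = n - j"
    then have "int r + int j = int n" using assms by simp
    then show "int n dvd int r + int j" by simp
  qed
  ultimately show ?thesis by (simp add: odd_delta_def)
qed

text \<open>The functions \<open>odd_delta n j\<close> with \<open>1 \<le> j \<le> (n - 1) div 2\<close> form a basis of the odd
  periodic functions, since these vanish at 0 and, for even \<open>n\<close>, at \<open>n div 2\<close>.\<close>

lemma odd_periodic_expansion:
  assumes n: "n > 0" and x: "periodic n x" "odd_fun x"
  shows "x l = (\<Sum>k = 0..<(n - 1) div 2. odd_delta n (Suc k) l * x (int (Suc k)))"
proof -
  let ?m = "(n - 1) div 2"
  define r where "r = nat (l mod int n)"
  have r: "r < n" "int r = l mod int n" using n by (simp_all add: r_def nat_less_iff)
  have xr: "x l = x (int r)" using periodic_mod[OF x(1), of l] r by simp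
  have reflect: "x (int (n - j)) = - x (int j)" if "j \<le> n" for j
  proof -
    have "x (int (n - j)) = x (- int j + int n)" using that by (simp add: of_nat_diff algebra_simps)
    also have "\<dots> = - x (int j)" using x by (simp only: periodic_def odd_fun_def)
    finally show ?thesis .
  qed
  have "odd_delta n (Suc k) l = of_bool (r = Suc k) - of_bool (r = n - Suc k)" if "k < ?m" for k
  proof -
    have "odd_delta n (Suc k) l = odd_delta n (Suc k) (int r)"
      using periodic_mod[OF odd_delta_periodic, of n "Suc k" l] r by simp
    then show ?thesis using that r odd_delta_residue[of "Suc k" n r] by simp
  qed
  then have "(\<Sum>k = 0..<?m. odd_delta n (Suc k) l * x (int (Suc k))) =
      (\<Sum>k = 0..<?m. of_bool (r = Suc k) * x (int (Suc k)))
      - (\<Sum>k = 0..<?m. of_bool (r = n - Suc k) * x (int (Suc k)))"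
    unfolding sum_subtractf[symmetric] by (intro sum.cong) (auto simp: left_diff_distrib)
  also have "(\<Sum>k = 0..<?m. of_bool (r = Suc k) * x (int (Suc k))) =
      (if 1 \<le> r \<and> r \<le> ?m then x (int r) else 0)"
  proof (cases "1 \<le> r \<and> r \<le> ?m")
    case True
    then show ?thesis by (subst sum.remove[of _ "r - 1"]) (auto intro!: sum.neutral)
  qed (auto intro!: sum.neutral)
  also have "(\<Sum>k = 0..<?m. of_bool (r = n - Suc k) * x (int (Suc k))) =
      (if n - ?m \<le> r then x (int (n - r)) else 0)"
  proof (cases "n - ?m \<le> r")
    case True
    then show ?thesis using r by (subst sum.remove[of _ "n - r - 1"]) (auto intro!: sum.neutral)
  next
    case False
    then have "r \<noteq> n - Suc k" if "k < ?m" for k using that by linarith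
    then show ?thesis using False by (auto intro!: sum.neutral)
  qed
  also have "(if 1 \<le> r \<and> r \<le> ?m then x (int r) else 0)
      - (if n - ?m \<le> r then x (int (n - r)) else 0) = x (int r)"
  proof -
    consider "r = 0" | "1 \<le> r" "r \<le> ?m" | "n = 2 * r" | "n - ?m \<le> r" "?m < r"
      using r(1) by linarith
    then show ?thesis
    proof cases
      case 1
      then show ?thesis using x(2)[unfolded odd_fun_def, rule_format, of 0] n by auto
    next
      case 2
      then have "\<not> n - ?m \<le> r" using n by linarith
      then show ?thesis using 2 by simp
    next
      case 3
      then show ?thesis using reflect[of r] n by auto
    next
      case 4
      then show ?thesis using reflect[of r] r by simp
    qed
  qed
  finally show ?thesis using xr by simp
qed

text \<open>Linear independence behind \<open>det_adapted_basis_nonzero\<close>. The odd part of the relation gives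
  \<open>a = 0\<close>. The rest is a recurrence that determines \<open>b\<close> on arithmetic progressions of step 2, where
  periodicity kills the increments \<open>\<alpha> \<plusminus> \<beta>\<close> and oddness the constants.\<close>

lemma odd_difference_decomposition_unique:
  assumes n: "n > 0" and a: "odd_fun a" and b: "periodic n b" "odd_fun b"
    and zero: "\<And>l. a l + (b (l + 1) - b (l - 1)) + \<alpha> + \<beta> * alternating l = 0"
    and \<beta>: "odd n \<Longrightarrow> \<beta> = 0"
  shows "a l = 0" "b l = 0" "\<alpha> = 0" "\<beta> = 0"
proof -
  have a0: "a l = 0" for l
  proof -
    have "a (- l) = - a l" "b (- l + 1) = - b (l - 1)" "b (- l - 1) = - b (l + 1)"
      using a b(2)[unfolded odd_fun_def, rule_format, of "l - 1"]
        b(2)[unfolded odd_fun_def, rule_format, of "l + 1"] by (auto simp: odd_fun_def)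
    moreover have "alternating (- l) = alternating l" by (simp add: alternating_def)
    ultimately show ?thesis using zero[of l] zero[of "- l"] by simp
  qed
  have step: "b (l + 1) = b (l - 1) - \<alpha> - \<beta> * alternating l" for l
    using zero[of l] a0[of l] by simp
  have b0: "b 0 = 0" using b(2)[unfolded odd_fun_def, rule_format, of 0] by simp
  (* The sign of the alternating term is constant along each class modulo 2. *)
  have even_pt: "b (2 * int i) = - int i * (\<alpha> - \<beta>)" for i
  proof (induction i)
    case (Suc i)
    then show ?case using step[of "2 * int i + 1"] by (simp add: alternating_def algebra_simps)
  qed (simp add: b0)
  have odd_pt: "b (2 * int i + 1) = b 1 - int i * (\<alpha> + \<beta>)" for i
  proof (induction i)
    case (Suc i)
    then show ?case using step[of "2 * int i + 2"] by (simp add: alternating_def algebra_simps)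
  qed simp
  have per: "b (l + int n) = b l" for l using b(1) by (simp add: periodic_def)
  have \<alpha>\<beta>: "\<alpha> = 0 \<and> \<beta> = 0"
  proof (cases "even n")
    case True
    then obtain h where h: "n = 2 * h" by auto
    have "int h * (\<alpha> - \<beta>) = 0" using even_pt[of h] per[of 0] b0 h by simp
    moreover have "int h * (\<alpha> + \<beta>) = 0" using odd_pt[of h] per[of 1] h by (simp add: add.commute)
    ultimately show ?thesis using n h by simp
  next
    case False
    (* For odd n the even numbers already meet every residue: go round the circle twice. *)
    have "b (2 * int n) = b 0" using per[of 0] per[of "int n"] by simp
    then have "int n * \<alpha> = 0" using even_pt[of n] b0 \<beta>[OF False] by simp
    then show ?thesis using n \<beta>[OF False] by simp
  qed
  have even0: "b l = 0" if "l \<ge> 0" "even l" for l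
    using even_pt[of "nat (l div 2)"] that \<alpha>\<beta> by simp
  have odd0: "b l = 0" if "l \<ge> 0" "odd l" for l
  proof (cases "even n")
    case False
    then show ?thesis using even0[of "l + int n"] per[of l] that by simp
  next
    case True
    have odd_const: "b l = b 1" if "l \<ge> 0" "odd l" for l
    proof -
      have "2 * int (nat (l div 2)) + 1 = l" using that by simp
      then show ?thesis using odd_pt[of "nat (l div 2)"] \<alpha>\<beta> by simp
    qed
    (* -1 and 1 lie in the same class modulo 2 and have opposite values. *)
    have "b (int n - 1) = b (- 1)" using per[of "- 1"] by simp
    also have "\<dots> = - b 1" using b(2) by (simp add: odd_fun_def)
    finally have "b 1 = 0" using odd_const[of "int n - 1"] True n by simp
    then show ?thesis using odd_const[OF that] by simp
  qed
  show "a l = 0" by (rule a0)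
  show "b l = 0"
    using even0[of "l mod int n"] odd0[of "l mod int n"] periodic_mod[OF b(1), of l] n by fastforce
  show "\<alpha> = 0" "\<beta> = 0" using \<alpha>\<beta> by simp_all
qed

section \<open>Block diagonal form of the forest operator\<close>

text \<open>The basis of odd functions, their differences, the constant function and, if \<open>n\<close> is even,
  the alternating function. The counts add up: with \<open>m = (n - 1) div 2\<close>, \<open>n\<close> is \<open>2 * m + 1\<close> or
  \<open>2 * m + 2\<close> according to its parity. Over the integers this is a basis only up to finite index,
  which does not matter for determinants.\<close>

definition adapted_basis :: "nat \<Rightarrow> nat \<Rightarrow> int \<Rightarrow> int" where
  "adapted_basis n c = (let m = (n - 1) div 2 in
     if c < m then odd_delta n (Suc c)
     else if c < 2 * m then
       (\<lambda>l. odd_delta n (Suc (c - m)) (l + 1) - odd_delta n (Suc (c - m)) (l - 1))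
     else if c = 2 * m then (\<lambda>_. 1) else alternating)"

lemma sum_split_add: "(\<Sum>k = 0..<a + b. f k) = (\<Sum>k = 0..<a. f k) + (\<Sum>k = 0..<b. f (a + k))"
  for f :: "nat \<Rightarrow> int"
  by (induction b) (simp_all add: add.assoc)

lemma adapted_basis_periodic:
  assumes c: "c < n"
  shows "periodic n (adapted_basis n c)"
proof -
  let ?m = "(n - 1) div 2"
  consider "c < ?m" | "?m \<le> c" "c < 2 * ?m" | "c = 2 * ?m" | "2 * ?m < c"
    by linarith
  then show ?thesis
  proof cases
    case 1
    then show ?thesis using odd_delta_periodic by (simp add: adapted_basis_def)
  next
    case 2
    define x where "x = odd_delta n (Suc (c - ?m))"
    have "x (l + 1 + int n) = x (l + 1)" "x (l - 1 + int n) = x (l - 1)" for l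
      using odd_delta_periodic unfolding x_def periodic_def by blast+
    moreover have "l + int n + 1 = l + 1 + int n" "l + int n - 1 = l - 1 + int n" for l
      by simp_all
    ultimately have "periodic n (\<lambda>l. x (l + 1) - x (l - 1))"
      unfolding periodic_def by metis
    then show ?thesis using 2 by (simp add: adapted_basis_def x_def Let_def)
  next
    case 3
    then show ?thesis by (simp add: adapted_basis_def periodic_def)
  next
    case 4
    have "even n"
    proof (rule ccontr)
      assume "odd n"
      then have "2 * ?m = n - 1" by simp
      then show False using 4 c by linarith
    qed
    then have "periodic n alternating" by (simp add: periodic_def alternating_def)
    moreover have "adapted_basis n c = alternating" using 4 by (simp add: adapted_basis_def)
    ultimately show ?thesis by simp
  qed
qed

text \<open>The matrix of \<open>forest_op\<close> on odd periodic functions.\<close>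

definition odd_block :: "nat \<Rightarrow> nat set \<Rightarrow> int mat" where
  "odd_block n S = mat ((n - 1) div 2) ((n - 1) div 2)
     (\<lambda>(i, j). forest_op S (odd_delta n (Suc j)) (int (Suc i)))"

lemma det_adapted_basis_nonzero:
  assumes n: "n > 0"
  shows "det (mat n n (\<lambda>(i, c). adapted_basis n c (int i))) \<noteq> 0"
proof
  let ?U = "mat n n (\<lambda>(i, c). adapted_basis n c (int i))"
  let ?m = "(n - 1) div 2"
  define e where "e = n - 2 * ?m"
  have e: "n = ?m + (?m + e)" "e = 1 \<and> odd n \<or> e = 2 \<and> even n"
    using n by (auto simp: e_def)
  assume "det ?U = 0"
  then obtain v where v: "v \<in> carrier_vec n" "v \<noteq> 0\<^sub>v n" "?U *\<^sub>v v = 0\<^sub>v n"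
    using det_0_iff_vec_prod_zero[of ?U n] by auto
  define a where "a l = (\<Sum>k = 0..<?m. odd_delta n (Suc k) l * v $ k)" for l
  define b where "b l = (\<Sum>k = 0..<?m. odd_delta n (Suc k) l * v $ (?m + k))" for l
  define \<beta> where "\<beta> = (if even n then v $ (2 * ?m + 1) else 0)"
  have oddf: "odd_fun (\<lambda>l. \<Sum>k = 0..<?m. odd_delta n (Suc k) l * f k)" for f
    using odd_delta_odd[of n] by (simp add: odd_fun_def sum_negf)
  have perf: "periodic n (\<lambda>l. \<Sum>k = 0..<?m. odd_delta n (Suc k) l * f k)" for f
    using odd_delta_periodic[of n] by (simp add: periodic_def)
  have coeff: "(\<Sum>k = 0..<?m. odd_delta n (Suc k) (int (Suc i)) * f k) = f i" if "i < ?m" for i f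
  proof -
    have "odd_delta n (Suc k) (int (Suc i)) = of_bool (i = k)" if "k < ?m" for k
      using odd_delta_residue[of "Suc k" n "Suc i"] that \<open>i < ?m\<close> by auto
    then have "(\<Sum>k = 0..<?m. odd_delta n (Suc k) (int (Suc i)) * f k) =
        (\<Sum>k = 0..<?m. of_bool (i = k) * f k)" by (intro sum.cong) auto
    also have "\<dots> = f i" using that by (subst sum.remove[of _ i]) (auto intro!: sum.neutral)
    finally show ?thesis .
  qed
  have lin: "(\<Sum>c = 0..<n. adapted_basis n c l * v $ c) =
      a l + (b (l + 1) - b (l - 1)) + v $ (2 * ?m) + \<beta> * alternating l" for l
  proof -
    have "(\<Sum>c = 0..<n. adapted_basis n c l * v $ c) = 
        (\<Sum>k = 0..<?m. adapted_basis n k l * v $ k)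
        + ((\<Sum>k = 0..<?m. adapted_basis n (?m + k) l * v $ (?m + k))
        + (\<Sum>k = 0..<e. adapted_basis n (?m + (?m + k)) l * v $ (?m + (?m + k))))"
      by (subst e(1)) (simp only: sum_split_add)
    also have "(\<Sum>k = 0..<?m. adapted_basis n k l * v $ k) = a l"
      by (simp add: a_def adapted_basis_def)
    also have "(\<Sum>k = 0..<?m. adapted_basis n (?m + k) l * v $ (?m + k)) = b (l + 1) - b (l - 1)"
      by (simp add: b_def adapted_basis_def left_diff_distrib sum_subtractf)
    also have "(\<Sum>k = 0..<e. adapted_basis n (?m + (?m + k)) l * v $ (?m + (?m + k))) =
        v $ (2 * ?m) + \<beta> * alternating l"
      using e(2) by (auto simp: \<beta>_def adapted_basis_def mult_2 numeral_2_eq_2)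
    finally show ?thesis by simp
  qed
  have zero: "a l + (b (l + 1) - b (l - 1)) + v $ (2 * ?m) + \<beta> * alternating l = 0" for l
  proof -
    define i where "i = nat (l mod int n)"
    have i: "i < n" "int i = l mod int n" using n by (simp_all add: i_def nat_less_iff)
    have "0 = (?U *\<^sub>v v) $ i" using v(3) i by simp
    also have "\<dots> = (\<Sum>c = 0..<n. adapted_basis n c (int i) * v $ c)"
      using i v(1) by (simp add: scalar_prod_def)
    also have "\<dots> = (\<Sum>c = 0..<n. adapted_basis n c l * v $ c)"
      using periodic_mod[OF adapted_basis_periodic, of _ n l] i by (intro sum.cong) auto
    finally show ?thesis using lin by simp
  qed
  have a_odd: "odd_fun a" and b_odd: "odd_fun b" and b_per: "periodic n b"
    unfolding a_def b_def by (rule oddf oddf perf)+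
  note unique = odd_difference_decomposition_unique[OF n a_odd b_per b_odd zero]
  have zeros: "a l = 0" "b l = 0" "v $ (2 * ?m) = 0" "\<beta> = 0" for l
    using unique by (auto simp: \<beta>_def)
  have "v $ c = 0" if "c < n" for c
  proof -
    have e2: "e \<le> 2" using e(2) by auto
    consider "c < ?m" | "?m \<le> c" "c < 2 * ?m" | "c = 2 * ?m" | "c = 2 * ?m + 1"
      using \<open>c < n\<close> e(1) e2 by linarith
    then show ?thesis
    proof cases
      case 1
      then show ?thesis using coeff[of c "\<lambda>k. v $ k"] zeros(1)[of "int (Suc c)"] by (simp add: a_def)
    next
      case 2
      then show ?thesis
        using coeff[of "c - ?m" "\<lambda>k. v $ (?m + k)"] zeros(2)[of "int (Suc (c - ?m))"]
        by (simp add: b_def)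
    next
      case 3
      then show ?thesis using zeros(3) by simp
    next
      case 4
      then have "even n" using e \<open>c < n\<close> by auto
      then show ?thesis using 4 zeros(4) by (simp add: \<beta>_def)
    qed
  qed
  then have "v = 0\<^sub>v n" using v(1) by (intro eq_vecI) auto
  then show False using v(2) by simp
qed

lemma adapted_basis_blocks:
  assumes "m = (n - 1) div 2"
  shows "k < m \<Longrightarrow> adapted_basis n k = odd_delta n (Suc k)"
    and "k < m \<Longrightarrow> adapted_basis n (m + k) =
      (\<lambda>l. odd_delta n (Suc k) (l + 1) - odd_delta n (Suc k) (l - 1))"
    and "adapted_basis n (m + m) = (\<lambda>_. 1)"
    and "adapted_basis n (m + Suc m) = alternating"
  unfolding adapted_basis_def Let_def assms[symmetric] by simp_all

text \<open>In the adapted basis the operator is block diagonal with the blocks \<open>A\<close>, \<open>A\<close> and the diagonal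
  block \<open>K\<close> of the eigenvalues 1 and, for even \<open>n\<close>, \<open>4 * p + 1\<close>. The change of basis
  \<open>?U\<close> need not be unimodular: its determinant is nonzero and cancels.\<close>

theorem det_circulant_forest_matrix:
  assumes S: "finite S" "\<And>t. t \<in> S \<Longrightarrow> 1 \<le> t \<and> 2 * t < n" and n: "n > 0"
  shows "det (forest_matrix n (circulant_graph n S)) =
    (if even n then 1 + 4 * int (card {t \<in> S. odd t}) else 1) * (det (odd_block n S))\<^sup>2"
proof -
  let ?M = "forest_matrix n (circulant_graph n S)"
  let ?U = "mat n n (\<lambda>(i, c). adapted_basis n c (int i))"
  define m where "m = (n - 1) div 2"
  define e where "e = n - 2 * m"
  define p where "p = card {t \<in> S. odd t}"
  define A where "A = odd_block n S"
  have ne: "n = m + (m + e)" and e: "e = 1 \<and> odd n \<or> e = 2 \<and> even n"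
    using n by (auto simp: e_def m_def)
  define K :: "int mat" where
    "K = mat e e (\<lambda>(i, j). if i = j then if i = 0 then 1 else 1 + 4 * int p else 0)"
  define B where "B = four_block_mat A (0\<^sub>m m e) (0\<^sub>m e m) K"
  define N where "N = four_block_mat A (0\<^sub>m m (m + e)) (0\<^sub>m (m + e) m) B"
  have A: "A \<in> carrier_mat m m" by (simp add: A_def odd_block_def m_def)
  have K: "K \<in> carrier_mat e e" by (simp add: K_def)
  have B: "B \<in> carrier_mat (m + e) (m + e)" unfolding B_def using A K by simp
  have N: "N \<in> carrier_mat n n" unfolding ne N_def using A B by (rule four_block_carrier_mat)
  have "det K = (if even n then 1 + 4 * int p else 1)"
    using e det_upper_triangular[of K e] K
    by (auto simp: K_def diag_mat_def upper_triangular_def numeral_2_eq_2)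
  moreover have "det B = det A * det K"
    unfolding B_def by (rule det_four_block_mat_lower_left_zero[OF A _ refl K]) simp
  moreover have "det N = det A * det B"
    unfolding N_def by (rule det_four_block_mat_lower_left_zero[OF A _ refl B]) simp
  ultimately have detN: "det N = (if even n then 1 + 4 * int p else 1) * (det A)\<^sup>2"
    by (simp add: power2_eq_square)
  have odd_op: "forest_op S (odd_delta n (Suc j)) l = (\<Sum>k = 0..<m. odd_delta n (Suc k) l * A $$ (k, j))"
    if "j < m" for j l
  proof -
    have "forest_op S (odd_delta n (Suc j)) l = (\<Sum>k = 0..<m.
        odd_delta n (Suc k) l * forest_op S (odd_delta n (Suc j)) (int (Suc k)))"
      unfolding m_def
      by (intro odd_periodic_expansion n forest_op_periodic forest_op_odd
          odd_delta_periodic odd_delta_odd)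
    then show ?thesis using that by (simp add: A_def odd_block_def m_def)
  qed
  have dims: "dim_row A = m" "dim_col A = m" "dim_row K = e" "dim_col K = e"
    "dim_row B = m + e" "dim_col B = m + e"
    using A B K by auto
  have "?M * ?U = ?U * N"
  proof (rule eq_matI)
    fix i c assume "i < dim_row (?U * N)" "c < dim_col (?U * N)"
    then have i: "i < n" and c: "c < n" using N by simp_all
    have "(?M * ?U) $$ (i, c) = (\<Sum>j = 0..<n. ?M $$ (i, j) * adapted_basis n c (int j))"
      using i c by (simp add: scalar_prod_def forest_matrix_def)
    also have "\<dots> = forest_op S (adapted_basis n c) (int i)"
      by (rule forest_matrix_mult_periodic[OF S i adapted_basis_periodic[OF c]])
    also have "\<dots> = (\<Sum>k = 0..<m. adapted_basis n k (int i) * N $$ (k, c))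
        + ((\<Sum>k = 0..<m. adapted_basis n (m + k) (int i) * N $$ (m + k, c))
        + (\<Sum>k = 0..<e. adapted_basis n (m + (m + k)) (int i) * N $$ (m + (m + k), c)))"
      (is "_ = ?N1 + (?N2 + ?N3)")
    proof -
      note blocks = adapted_basis_blocks[OF m_def]
      consider "c < m" | k where "c = m + k" "k < m" | "c = m + m" | "c = m + Suc m" "e = 2"
      proof -
        have "c < m + (m + e)" using c ne by simp
        then have "c < m \<or> (m \<le> c \<and> c - m < m) \<or> c = m + m \<or> c = m + Suc m \<and> e = 2"
          using e by auto
        then show thesis using that by (metis le_add_diff_inverse)
      qed
      then show ?thesis
      proof cases
        case 1
        have "?N1 = (\<Sum>k = 0..<m. odd_delta n (Suc k) (int i) * A $$ (k, c))"
          using 1 by (intro sum.cong) (auto simp: blocks N_def dims)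
        moreover have "?N2 = 0" "?N3 = 0"
          using 1 by (auto intro!: sum.neutral simp: N_def dims)
        ultimately show ?thesis using odd_op[OF 1] 1 by (simp add: blocks)
      next
        case (2 k)
        define x where "x = odd_delta n (Suc k)"
        have "adapted_basis n c = (\<lambda>l. x (l + 1) - x (l + - 1))"
          using 2 by (simp add: blocks x_def)
        then have "forest_op S (adapted_basis n c) (int i) =
            forest_op S x (int i + 1) - forest_op S x (int i - 1)"
          by (simp only: forest_op_diff forest_op_shift) simp
        also have "\<dots> = (\<Sum>j = 0..<m. (odd_delta n (Suc j) (int i + 1)
            - odd_delta n (Suc j) (int i - 1)) * A $$ (j, k))"
          using odd_op[OF 2(2)] by (simp add: x_def left_diff_distrib sum_subtractf)
        also have "\<dots> = ?N2"
          using 2 by (intro sum.cong) (auto simp: blocks N_def B_def dims)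
        also have "\<dots> = ?N1 + (?N2 + ?N3)"
          using 2 by (simp add: N_def B_def dims)
        finally show ?thesis .
      next
        case 3
        have "?N1 = 0" "?N2 = 0"
          using 3 e by (auto intro!: sum.neutral simp: N_def B_def dims)
        moreover have "?N3 = 1"
          using e 3 by (auto simp: N_def B_def dims K_def blocks numeral_2_eq_2)
        ultimately show ?thesis using 3 by (simp add: blocks forest_op_const)
      next
        case 4
        have "?N1 = 0" "?N2 = 0"
          using 4 by (auto intro!: sum.neutral simp: N_def B_def dims)
        moreover have "?N3 = (1 + 4 * int p) * alternating (int i)"
          using 4 by (auto simp: N_def B_def dims K_def blocks[simplified] numeral_2_eq_2)
        ultimately show ?thesis using 4 forest_op_alternating[OF S(1)] blocks(4) by (simp add: p_def)
      qed
    qed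
    also have "\<dots> = (\<Sum>k = 0..<m + (m + e). adapted_basis n k (int i) * N $$ (k, c))"
      by (simp only: sum_split_add)
    also have "\<dots> = (?U * N) $$ (i, c)"
      unfolding ne[symmetric] using i c N by (simp add: scalar_prod_def)
    finally show "(?M * ?U) $$ (i, c) = (?U * N) $$ (i, c)" .
  qed (use N in \<open>simp_all add: forest_matrix_def\<close>)
  then have "det (?M * ?U) = det (?U * N)" by simp
  moreover have "det (?M * ?U) = det ?M * det ?U" by (rule det_mult[of _ n]) simp_all
  moreover have "det (?U * N) = det ?U * det N" by (rule det_mult[OF _ N]) simp
  ultimately have "det ?M * det ?U = det ?U * det N" by simp
  then have "det ?M = det N" using det_adapted_basis_nonzero[OF n] by simp
  then show ?thesis using detN by (simp add: p_def A_def)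
qed

section \<open>Square-free parts of the forest numbers\<close>

theorem theorem3:
  fixes k p q :: nat and s :: "nat \<Rightarrow> nat" and f :: "nat \<Rightarrow> nat"
  assumes "k \<ge> 1"
    and "1 \<le> s 1"
    and "strict_mono_on {1..k} s"
    and "\<And>n. real (s k) < real n / 2 \<Longrightarrow>
           f n = card (rooted_spanning_forests (circulant_graph n (s ` {1..k})))"
    and "p = card {i \<in> {1..k}. odd (s i)}"
    and "q = squarefree_part (4 * p + 1)"
  shows "\<exists>a :: nat \<Rightarrow> int. \<forall>n. real (s k) < real n / 2 \<longrightarrow>
           (odd n \<longrightarrow> int (f n) = (a n)\<^sup>2) \<and>
           (even n \<longrightarrow> int (f n) = int q * (a n)\<^sup>2)"
proof -
  define S where "S = s ` {1..k}"
  define r where "r = square_part (4 * p + 1)"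
  define a where "a n = (if even n then int r * det (odd_block n S) else det (odd_block n S))" for n
  have "inj_on s {1..k}" by (rule strict_mono_on_imp_inj_on[OF assms(3)])
  moreover have "{t \<in> S. odd t} = s ` {i \<in> {1..k}. odd (s i)}" by (auto simp: S_def)
  ultimately have p: "card {t \<in> S. odd t} = p"
    unfolding assms(5) by (metis (no_types, lifting) card_image inj_on_subset mem_Collect_eq subsetI)
  have qr: "1 + 4 * int p = int q * (int r)\<^sup>2"
  proof -
    have "4 * p + 1 = q * r\<^sup>2" unfolding assms(6) r_def by (rule squarefree_decompose)
    then have "int (4 * p + 1) = int (q * r\<^sup>2)" by (simp only:)
    then show ?thesis by simp
  qed
  have main: "int (f n) = (if even n then 1 + 4 * int p else 1) * (det (odd_block n S))\<^sup>2"
    if n: "real (s k) < real n / 2" for n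
  proof -
    have sk: "2 * s k < n" using n by linarith
    have jumps: "1 \<le> t \<and> 2 * t < n" if "t \<in> S" for t
    proof -
      obtain i where i: "i \<in> {1..k}" "t = s i" using \<open>t \<in> S\<close> by (auto simp: S_def)
      have mono: "s j \<le> s l" if "1 \<le> j" "j \<le> l" "l \<le> k" for j l
        using strict_mono_onD[OF assms(3), of j l] that by (cases "j = l") auto
      show ?thesis using mono[of 1 i] mono[of i k] i sk assms(2) by auto
    qed
    have simple: "simple_ugraph (circulant_graph n S)"
      using jumps by (intro simple_circulant_graph) (meson less_imp_le)
    have "int (f n) = det (forest_matrix n (circulant_graph n S))"
      using assms(4)[OF n] matrix_forest_theorem[OF simple, of n]
      by (simp add: S_def circulant_graph_def)
    also have "\<dots> = (if even n then 1 + 4 * int (card {t \<in> S. odd t}) else 1) *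
        (det (odd_block n S))\<^sup>2"
    proof (rule det_circulant_forest_matrix)
      show "finite S" by (simp add: S_def)
      show "n > 0" using sk by simp
    qed (rule jumps)
    finally show ?thesis unfolding p .
  qed
  show ?thesis
    by (rule exI[of _ a]) (auto simp: main a_def qr power_mult_distrib)
qed

end
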